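(* Let $(N, \cdot)$ be a $4$-algebra and $\Omega$ a Bernstein operator on $(N, \cdot)$. Then the map $$\vartheta : \bigl(\mathcal{A}(N, \cdot, \Omega), \bullet\bigr) \to \mathrm{Aut}_{\mathrm{Ber}}\bigl(N \ltimes_{(\cdot,\,\Omega)} k\bigr), \qquad \vartheta(v, f)(x, \alpha) := \bigl(f(x) + \alpha\, v,\ \alpha\bigr),$$ defined for any $(v, f) \in \mathcal{A}(N, \cdot, \Omega)$ and $(x, \alpha) \in N \times k$, is an isomorphism of groups.
   Context: Throughout, $k$ is an infinite field of characteristic $\neq 2$; all vector spaces and (bi)linear maps are over $k$ (vector spaces may be infinite dimensional). An algebra is a vector space $A$ with a bilinear multiplication $A \times A \to A$ (no associativity or unit assumed); $a^2$ denotes the product of $a$ with itself. A baric algebra is a pair $(A, \omega)$ consisting of a commutative algebra $A$ and a non-zero algebra morphism $\omega : A \to k$, called the weight. A Bernstein algebra is a baric algebra $(A, \omega)$ such that $(a^2)^2 = \omega(a)^2\, a^2$ for all $a \in A$. A morphism of Bernstein algebras $(A, \omega_A) \to (B, \omega_B)$ is an algebra map $\psi : A \to B$ with $\omega_B \circ \psi = \omega_A$. $\mathrm{Aut}_{\mathrm{Ber}}(A)$ denotes the group of automorphisms of a Bernstein algebra $A$ (under composition). A $4$-algebra is a commutative algebra $(N, \cdot)$ such that $(x^2)^2 = 0$ for all $x \in N$. A Bernstein operator on a $4$-algebra $(N, \cdot)$ is an idempotent $\Omega = \Omega^2 \in \mathrm{End}_k(N)$ such that $x^2 \cdot \Omega(x)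 = 0$ and $\Omega(x)^2 + \Omega(x^2) = x^2$ for all $x \in N$ (here $\Omega(x)^2 = \Omega(x) \cdot \Omega(x)$). $\mathrm{Aut}_{\mathrm{Alg}}(N, \cdot)$ denotes the automorphism group of the algebra $(N, \cdot)$. For a $4$-algebra $(N, \cdot)$ and a Bernstein operator $\Omega$ on it, the semidirect product $N \ltimes_{(\cdot,\,\Omega)} k$ is the Bernstein algebra with underlying vector space $N \times k$, multiplication $$(x, \alpha) \circ (y, \beta) := \bigl(x \cdot y + \tfrac{1}{2}\alpha\, \Omega(y) + \tfrac{1}{2}\beta\, \Omega(x),\ \alpha\beta\bigr)$$ and weight $\pi_2(x, \alpha) = \alpha$. $\mathcal{A}(N, \cdot, \Omega)$ denotes the set of all pairs $(v, f) \in N \times \mathrm{Aut}_{\mathrm{Alg}}(N, \cdot)$ such that $$\Omega(v) = v - v^2, \qquad f\bigl(\Omega(x)\bigr) - \Omega\bigl(f(x)\bigr) = 2\, f(x) \cdot v \ \text{ for all } x \in N.$$ It is a group with the multiplication $(w, g) \bullet (v, f) := (w + g(v),\ g \circ f)$; it is a subgroup of the canonical semidirect product of groups $(N, +) \ltimes \mathrm{GL}_k(N)$, i.e. $N \times \mathrm{GL}_k(N)$ with the multiplication given by the same formula. *)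

theory Defs
  imports "HOL-Algebra.Group" "HOL-Analysis.Product_Vector"
begin

text \<open>
  Vector spaces are given by a scalar multiplication on a type, in the style of
  \<^locale>\<open>vector_space\<close>; the ground field \<open>k\<close> is the type \<open>'k\<close>, viewed as an algebra over itself
  through \<open>(*)\<close>.
\<close>

locale nonassoc_algebra = vector_space smul
  for smul :: "'k::field \<Rightarrow> 'a::ab_group_add \<Rightarrow> 'a" +
  fixes mul :: "'a \<Rightarrow> 'a \<Rightarrow> 'a"
  assumes linear_mult_left: "Vector_Spaces.linear smul smul (\<lambda>x. mul x y)"
    and linear_mult_right: "Vector_Spaces.linear smul smul (\<lambda>y. mul x y)"

locale comm_nonassoc_algebra = nonassoc_algebra smul mul
  for smul :: "'k::field \<Rightarrow> 'a::ab_group_add \<Rightarrow> 'a" and mul +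
  assumes mult_commute: "mul x y = mul y x"

definition algebra_hom ::
  "('k::field \<Rightarrow> 'a::ab_group_add \<Rightarrow> 'a) \<Rightarrow> ('a \<Rightarrow> 'a \<Rightarrow> 'a) \<Rightarrow>
   ('k \<Rightarrow> 'b::ab_group_add \<Rightarrow> 'b) \<Rightarrow> ('b \<Rightarrow> 'b \<Rightarrow> 'b) \<Rightarrow> ('a \<Rightarrow> 'b) \<Rightarrow> bool"
  where "algebra_hom sA mA sB mB f \<longleftrightarrow>
    Vector_Spaces.linear sA sB f \<and> (\<forall>x y. f (mA x y) = mB (f x) (f y))"

definition algebra_auts ::
  "('k::field \<Rightarrow> 'a::ab_group_add \<Rightarrow> 'a) \<Rightarrow> ('a \<Rightarrow> 'a \<Rightarrow> 'a) \<Rightarrow> ('a \<Rightarrow> 'a) set"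
  where "algebra_auts smul mul = {f. algebra_hom smul mul smul mul f \<and> bij f}"


locale baric_algebra = comm_nonassoc_algebra smul mul
  for smul :: "'k::field \<Rightarrow> 'a::ab_group_add \<Rightarrow> 'a" and mul +
  fixes weight :: "'a \<Rightarrow> 'k"
  assumes weight_hom: "algebra_hom smul mul (*) (*) weight"
    and weight_nonzero: "\<exists>a. weight a \<noteq> 0"

locale bernstein_algebra = baric_algebra smul mul weight
  for smul :: "'k::field \<Rightarrow> 'a::ab_group_add \<Rightarrow> 'a" and mul and weight +
  assumes bernstein: "mul (mul a a) (mul a a) = smul ((weight a)\<^sup>2) (mul a a)"

definition bernstein_hom ::
  "('k::field \<Rightarrow> 'a::ab_group_add \<Rightarrow> 'a) \<Rightarrow> ('a \<Rightarrow> 'a \<Rightarrow> 'a) \<Rightarrow> ('a \<Rightarrow> 'k) \<Rightarrow>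
   ('k \<Rightarrow> 'b::ab_group_add \<Rightarrow> 'b) \<Rightarrow> ('b \<Rightarrow> 'b \<Rightarrow> 'b) \<Rightarrow> ('b \<Rightarrow> 'k) \<Rightarrow> ('a \<Rightarrow> 'b) \<Rightarrow> bool"
  where "bernstein_hom sA mA wA sB mB wB \<psi> \<longleftrightarrow> algebra_hom sA mA sB mB \<psi> \<and> wB \<circ> \<psi> = wA"

definition Aut_Ber ::
  "('k::field \<Rightarrow> 'a::ab_group_add \<Rightarrow> 'a) \<Rightarrow> ('a \<Rightarrow> 'a \<Rightarrow> 'a) \<Rightarrow> ('a \<Rightarrow> 'k) \<Rightarrow> ('a \<Rightarrow> 'a) monoid"
  where "Aut_Ber smul mul weight =
    \<lparr>carrier = {\<psi>. bernstein_hom smul mul weight smul mul weight \<psi> \<and> bij \<psi>},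
     monoid.mult = (\<circ>), one = id\<rparr>"


locale four_algebra = comm_nonassoc_algebra smul mul
  for smul :: "'k::field \<Rightarrow> 'n::ab_group_add \<Rightarrow> 'n" and mul +
  assumes square_square_zero: "mul (mul x x) (mul x x) = 0"

locale bernstein_operator = four_algebra smul mul
  for smul :: "'k::field \<Rightarrow> 'n::ab_group_add \<Rightarrow> 'n" and mul +
  fixes \<Omega> :: "'n \<Rightarrow> 'n"
  assumes linear_operator: "Vector_Spaces.linear smul smul \<Omega>"
    and idempotent: "\<Omega> \<circ> \<Omega> = \<Omega>"
    and square_mul_operator: "mul (mul x x) (\<Omega> x) = 0"
    and operator_square: "mul (\<Omega> x) (\<Omega> x) + \<Omega> (mul x x) = mul x x"


abbreviation semidirect_smul ::
  "('k::field \<Rightarrow> 'n::ab_group_add \<Rightarrow> 'n) \<Rightarrow> 'k \<Rightarrow> 'n \<times> 'k \<Rightarrow> 'n \<times> 'k"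
  where "semidirect_smul smul \<equiv> module_prod.scale smul (*)"

definition semidirect_mul ::
  "('k::field \<Rightarrow> 'n::ab_group_add \<Rightarrow> 'n) \<Rightarrow> ('n \<Rightarrow> 'n \<Rightarrow> 'n) \<Rightarrow> ('n \<Rightarrow> 'n) \<Rightarrow>
   'n \<times> 'k \<Rightarrow> 'n \<times> 'k \<Rightarrow> 'n \<times> 'k"
  where "semidirect_mul smul mul \<Omega> = (\<lambda>(x, \<alpha>) (y, \<beta>).
    (mul x y + smul (1/2 * \<alpha>) (\<Omega> y) + smul (1/2 * \<beta>) (\<Omega> x), \<alpha> * \<beta>))"

lemma (in bernstein_operator) bernstein_algebra_semidirect:
  assumes "(2::'k) \<noteq> 0"
  shows "bernstein_algebra (semidirect_smul smul) (semidirect_mul smul mul \<Omega>) snd"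
proof -
  interpret K: vector_space "(*) :: 'k \<Rightarrow> 'k \<Rightarrow> 'k"
    by unfold_locales (auto simp: algebra_simps)
  interpret P: vector_space_prod smul "(*) :: 'k \<Rightarrow> 'k \<Rightarrow> 'k" ..
  interpret L: Vector_Spaces.linear smul smul "\<lambda>x. mul x y" for y
    by (rule linear_mult_left)
  interpret R: Vector_Spaces.linear smul smul "\<lambda>y. mul x y" for x
    by (rule linear_mult_right)
  interpret O: Vector_Spaces.linear smul smul \<Omega>
    by (rule linear_operator)
  note lin = L.add L.scale R.add R.scale O.add O.scale
  have idem: "\<Omega> (\<Omega> x) = \<Omega> x" for x
    using idempotent by (metis comp_apply)
  have half: "smul (1/2) x + smul (1/2) x = x" for x
    using assms by (simp flip: scale_left_distrib)
  have half': "smul (\<alpha>/2) x + smul (\<alpha>/2) x = smul \<alpha> x" for \<alpha> x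
    using half[of "smul \<alpha> x"] by simp
  have sq: "semidirect_mul smul mul \<Omega> (x, \<alpha>) (x, \<alpha>) = (mul x x + smul \<alpha> (\<Omega> x), \<alpha> * \<alpha>)"
    for x \<alpha>
    by (simp add: semidirect_mul_def add.assoc half')
  have comm: "semidirect_mul smul mul \<Omega> a b = semidirect_mul smul mul \<Omega> b a" for a b
    by (cases a; cases b) (simp add: semidirect_mul_def mult_commute algebra_simps)
  define h where "h \<alpha> y = smul (1/2 * \<alpha>) (\<Omega> y)" for \<alpha> y
  have h: "h \<alpha> (y + z) = h \<alpha> y + h \<alpha> z" "h (\<alpha> + \<beta>) y = h \<alpha> y + h \<beta> y"
    "h \<alpha> (smul c y) = smul c (h \<alpha> y)" "h (c * \<alpha>) y = smul c (h \<alpha> y)" for \<alpha> \<beta> c y z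
       apply (simp only: h_def O.add scale_right_distrib)
      apply (simp only: h_def distrib_left scale_left_distrib)
     apply (simp only: h_def O.scale scale_scale mult.commute)
    apply (simp only: h_def scale_scale mult.left_commute)
    done
  have right: "Vector_Spaces.linear (semidirect_smul smul) (semidirect_smul smul)
    (\<lambda>b. semidirect_mul smul mul \<Omega> a b)" for a
    unfolding Vector_Spaces.linear_iff semidirect_mul_def h_def[symmetric]
    by (auto simp only: P.p.vector_space_axioms P.scale_def split_beta h R.add R.scale
        scale_right_distrib fst_add snd_add fst_conv snd_conv add_Pair distrib_left
        mult.left_commute add_ac)
  have left: "Vector_Spaces.linear (semidirect_smul smul) (semidirect_smul smul)
    (\<lambda>b. semidirect_mul smul mul \<Omega> b a)" for a
    using right[of a] unfolding comm[of a] .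
  have bern: "semidirect_mul smul mul \<Omega> (semidirect_mul smul mul \<Omega> a a)
      (semidirect_mul smul mul \<Omega> a a)
    = semidirect_smul smul ((snd a)\<^sup>2) (semidirect_mul smul mul \<Omega> a a)" for a
  proof (cases a)
    case (Pair x \<alpha>)
    have "mul (\<Omega> x) (mul x x) = 0"
      using square_mul_operator mult_commute by metis
    then have "mul (mul x x + smul \<alpha> (\<Omega> x)) (mul x x + smul \<alpha> (\<Omega> x))
        + smul (\<alpha> * \<alpha>) (\<Omega> (mul x x + smul \<alpha> (\<Omega> x)))
      = smul (\<alpha> * \<alpha>) (mul (\<Omega> x) (\<Omega> x) + \<Omega> (mul x x)) + smul (\<alpha> * \<alpha>) (smul \<alpha> (\<Omega> x))"
      by (simp add: lin square_square_zero square_mul_operator idem scale_right_distrib add_ac)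
    also have "\<dots> = smul (\<alpha> * \<alpha>) (mul x x + smul \<alpha> (\<Omega> x))"
      by (simp add: operator_square scale_right_distrib)
    finally show ?thesis
      unfolding Pair sq by (simp add: P.scale_def power2_eq_square)
  qed
  have snd_hom: "algebra_hom (semidirect_smul smul) (semidirect_mul smul mul \<Omega>) (*) (*) snd"
    unfolding algebra_hom_def using P.linear_snd
    by (auto simp: semidirect_mul_def)
  have snd_nonzero: "\<exists>a :: 'n \<times> 'k. snd a \<noteq> 0"
    by (rule exI[of _ "(0, 1)"]) simp
  show ?thesis
    by (intro bernstein_algebra.intro baric_algebra.intro comm_nonassoc_algebra.intro
        nonassoc_algebra.intro bernstein_algebra_axioms.intro baric_algebra_axioms.intro
        comm_nonassoc_algebra_axioms.intro nonassoc_algebra_axioms.intro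
        P.p.vector_space_axioms left right comm bern snd_hom snd_nonzero)
qed


definition semidirect_GL ::
  "('k::field \<Rightarrow> 'n::ab_group_add \<Rightarrow> 'n) \<Rightarrow> ('n \<times> ('n \<Rightarrow> 'n)) monoid"
  where "semidirect_GL smul =
    \<lparr>carrier = UNIV \<times> {f. Vector_Spaces.linear smul smul f \<and> bij f},
     monoid.mult = (\<lambda>(w, g) (v, f). (w + g v, g \<circ> f)), one = (0, id)\<rparr>"

definition A_group ::
  "('k::field \<Rightarrow> 'n::ab_group_add \<Rightarrow> 'n) \<Rightarrow> ('n \<Rightarrow> 'n \<Rightarrow> 'n) \<Rightarrow> ('n \<Rightarrow> 'n) \<Rightarrow>
   ('n \<times> ('n \<Rightarrow> 'n)) monoid"
  where "A_group smul mul \<Omega> = (semidirect_GL smul)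
    \<lparr>carrier := {(v, f). f \<in> algebra_auts smul mul \<and> \<Omega> v = v - mul v v \<and>
      (\<forall>x. f (\<Omega> x) - \<Omega> (f x) = smul 2 (mul (f x) v))}\<rparr>"

definition theta ::
  "('k::field \<Rightarrow> 'n::ab_group_add \<Rightarrow> 'n) \<Rightarrow> 'n \<times> ('n \<Rightarrow> 'n) \<Rightarrow> 'n \<times> 'k \<Rightarrow> 'n \<times> 'k"
  where "theta smul = (\<lambda>(v, f) (x, \<alpha>). (f x + smul \<alpha> v, \<alpha>))"

end

theory Submission
  imports Defs
begin

text \<open>
  In \<open>N \<ltimes> k\<close> the subspace \<open>N \<times> 0\<close> is the kernel of the weight, and \<open>(0, 1)\<close> has weight one.  A linear
  map \<open>\<psi>\<close> that preserves the weight therefore sends \<open>(x, 0)\<close> to some \<open>(f x, 0)\<close> and \<open>(0, 1)\<close> to some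
  \<open>(v, 1)\<close>, and by linearity it is the map \<open>\<theta>(v, f)\<close>; the pair \<open>(v, f)\<close> is unique.  So the maps
  \<open>\<theta>(v, f)\<close> are exactly the candidates for automorphisms of \<open>N \<ltimes> k\<close>, and what has to be seen is
  when such a map is one.

  It is linear, or bijective, exactly when \<open>f\<close> is.  As the product is bilinear and commutative,
  multiplicativity need only be tested on products of two elements of \<open>N \<times> 0\<close>, of \<open>(0, 1)\<close>
  with itself, and of an element of \<open>N \<times> 0\<close> with \<open>(0, 1)\<close>.  These three tests say, in turn, that \<open>f\<close> is an algebra map, that
  \<open>v = v\<^sup>2 + \<Omega>(v)\<close>, and that \<open>f(\<Omega>(x))/2 = f(x) \<cdot> v + \<Omega>(f(x))/2\<close>; clearing the denominator gives the
  defining conditions of \<open>\<A>(N, \<cdot>, \<Omega>)\<close>.  Hence \<open>(v, f)\<close> lies in \<open>\<A>(N, \<cdot>, \<Omega>)\<close> if and only if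
  \<open>\<theta>(v, f)\<close> is an automorphism (\<open>theta_in_Aut_Ber_iff\<close>).

  Finally \<open>\<theta>\<close> turns \<open>\<bullet>\<close> into composition.  With the equivalence, closure of \<open>\<A>(N, \<cdot>, \<Omega>)\<close> under
  \<open>\<bullet>\<close> and the existence of inverses are inherited from the automorphism group, so no computation
  with the defining conditions is needed for them.
\<close>

section \<open>Automorphism groups\<close>

lemma (in nonassoc_algebra) group_Aut_Ber: "group (Aut_Ber smul mul weight)"
proof (rule groupI)
  fix \<psi> \<phi>
  assume "\<psi> \<in> carrier (Aut_Ber smul mul weight)" "\<phi> \<in> carrier (Aut_Ber smul mul weight)"
  then show "\<psi> \<otimes>\<^bsub>Aut_Ber smul mul weight\<^esub> \<phi> \<in> carrier (Aut_Ber smul mul weight)"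
    by (auto simp: Aut_Ber_def bernstein_hom_def algebra_hom_def Vector_Spaces.linear_iff
        fun_eq_iff intro: bij_comp)
next
  show "\<one>\<^bsub>Aut_Ber smul mul weight\<^esub> \<in> carrier (Aut_Ber smul mul weight)"
    by (simp add: Aut_Ber_def bernstein_hom_def algebra_hom_def linear_id id_def[symmetric])
next
  fix \<psi>
  assume "\<psi> \<in> carrier (Aut_Ber smul mul weight)"
  then have bij: "bij \<psi>" and lin: "Vector_Spaces.linear smul smul \<psi>"
    and mult: "\<And>x y. \<psi> (mul x y) = mul (\<psi> x) (\<psi> y)" and weight: "\<And>x. weight (\<psi> x) = weight x"
    by (auto simp: Aut_Ber_def bernstein_hom_def algebra_hom_def fun_eq_iff)
  have right_inverse: "\<psi> (inv_into UNIV \<psi> x) = x" for x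
    using bij by (simp add: bij_is_surj surj_f_inv_f)
  have inverse_eqI: "inv_into UNIV \<psi> x = y" if "\<psi> y = x" for x y
    using bij that by (auto simp: bij_is_inj)
  have "inv_into UNIV \<psi> \<in> carrier (Aut_Ber smul mul weight)"
    using bij lin weight[of "inv_into UNIV \<psi> _"]
    by (auto simp: Aut_Ber_def bernstein_hom_def algebra_hom_def Vector_Spaces.linear_iff
        fun_eq_iff right_inverse mult bij_imp_bij_inv intro!: inverse_eqI)
  moreover have "inv_into UNIV \<psi> \<circ> \<psi> = id"
    using bij by (simp add: bij_is_inj)
  ultimately show "\<exists>\<phi>\<in>carrier (Aut_Ber smul mul weight).
      \<phi> \<otimes>\<^bsub>Aut_Ber smul mul weight\<^esub> \<psi> = \<one>\<^bsub>Aut_Ber smul mul weight\<^esub>"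
    by (auto simp: Aut_Ber_def)
qed (auto simp: Aut_Ber_def)

section \<open>Weight-preserving linear maps of the semidirect product\<close>

lemma theta_apply [simp]: "theta smul (v, f) (x, \<alpha>) = (f x + smul \<alpha> v, \<alpha>)"
  by (simp add: theta_def)

context vector_space
begin

lemma vector_space_prod_field: "vector_space_prod scale (*)"
  by unfold_locales (auto simp: algebra_simps)

lemma semidirect_smul_apply [simp]: "semidirect_smul scale c (x, \<alpha>) = (scale c x, c * \<alpha>)"
proof -
  interpret vector_space_prod scale "(*)"
    by (rule vector_space_prod_field)
  show ?thesis
    by (simp add: scale_def)
qed

lemma vector_space_semidirect_smul: "vector_space (semidirect_smul scale)"
proof -
  interpret vector_space_prod scale "(*)"
    by (rule vector_space_prod_field)
  show ?thesis
    by (rule p.vector_space_axioms)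
qed

lemma linear_semidirect_iff:
  "Vector_Spaces.linear (semidirect_smul scale) (semidirect_smul scale) \<psi> \<longleftrightarrow>
    (\<forall>a b. \<psi> (a + b) = \<psi> a + \<psi> b) \<and>
    (\<forall>c a. \<psi> (semidirect_smul scale c a) = semidirect_smul scale c (\<psi> a))"
  by (simp add: Vector_Spaces.linear_iff vector_space_axioms vector_space_semidirect_smul)

lemma inj_theta: "inj (theta scale)"
proof (rule injI, clarify)
  fix v w f g
  assume eq: "theta scale (v, f) = theta scale (w, g)"
  have "f x = g x" for x
    using fun_cong[OF eq, of "(x, 0)"] by simp
  then show "v = w \<and> f = g"
    using fun_cong[OF eq, of "(0, 1)"] by auto
qed

lemma weight_preserving_linear_is_theta:
  assumes lin: "Vector_Spaces.linear (semidirect_smul scale) (semidirect_smul scale) \<psi>"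
    and weight: "snd \<circ> \<psi> = snd"
  shows "\<psi> = theta scale (fst (\<psi> (0, 1)), \<lambda>x. fst (\<psi> (x, 0)))"
proof (rule ext, clarify)
  fix x \<alpha>
  have "\<psi> (x, \<alpha>) = \<psi> ((x, 0) + semidirect_smul scale \<alpha> (0, 1))"
    by simp
  also have "\<dots> = \<psi> (x, 0) + semidirect_smul scale \<alpha> (\<psi> (0, 1))"
    using lin by (simp only: linear_semidirect_iff)
  also have "\<psi> (x, 0) = (fst (\<psi> (x, 0)), 0)"
    using fun_cong[OF weight, of "(x, 0)"] by (simp add: prod_eq_iff)
  also have "\<psi> (0, 1) = (fst (\<psi> (0, 1)), 1)"
    using fun_cong[OF weight, of "(0, 1)"] by (simp add: prod_eq_iff)
  finally show "\<psi> (x, \<alpha>) = theta scale (fst (\<psi> (0, 1)), \<lambda>x. fst (\<psi> (x, 0))) (x, \<alpha>)"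
    by simp
qed

lemma linear_theta_iff:
  "Vector_Spaces.linear (semidirect_smul scale) (semidirect_smul scale) (theta scale (v, f)) \<longleftrightarrow>
    Vector_Spaces.linear scale scale f"
proof
  assume "Vector_Spaces.linear (semidirect_smul scale) (semidirect_smul scale) (theta scale (v, f))"
  then have "theta scale (v, f) ((x, 0) + (y, 0)) = theta scale (v, f) (x, 0) + theta scale (v, f) (y, 0)"
    and "theta scale (v, f) (semidirect_smul scale c (x, 0)) =
      semidirect_smul scale c (theta scale (v, f) (x, 0))" for x y c
    by (simp_all only: linear_semidirect_iff)
  then show "Vector_Spaces.linear scale scale f"
    by (simp add: Vector_Spaces.linear_iff vector_space_axioms)
next
  assume "Vector_Spaces.linear scale scale f"
  then show "Vector_Spaces.linear (semidirect_smul scale) (semidirect_smul scale) (theta scale (v, f))"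
    unfolding linear_semidirect_iff by (auto simp: Vector_Spaces.linear_iff algebra_simps)
qed

text \<open>
  On the slice of weight \<open>\<alpha>\<close>, the map is \<open>f\<close> followed by the translation by \<open>\<alpha> v\<close>; hence it is
  bijective on the slice as soon as \<open>f\<close> is bijective, and the slice of weight zero recovers \<open>f\<close>.
\<close>
lemma bij_theta_iff: "bij (theta scale (v, f)) \<longleftrightarrow> bij f"
proof
  assume bij: "bij (theta scale (v, f))"
  show "bij f"
  proof (rule bijI)
    show "inj f"
    proof (rule injI)
      fix x y
      assume "f x = f y"
      then have "theta scale (v, f) (x, 0) = theta scale (v, f) (y, 0)"
        by simp
      then have "(x, 0 :: 'a) = (y, 0)"
        by (rule injD[OF bij_is_inj[OF bij]])
      then show "x = y"
        by simp
    qed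
    show "surj f"
      unfolding surj_def
    proof
      fix y
      obtain x \<alpha> where "theta scale (v, f) (x, \<alpha>) = (y, 0)"
        using bij_is_surj[OF bij] by (metis surjD surj_pair)
      then show "\<exists>x. y = f x"
        by auto
    qed
  qed
next
  assume bij: "bij f"
  show "bij (theta scale (v, f))"
  proof (rule bijI)
    show "inj (theta scale (v, f))"
      using bij by (auto intro!: injI simp: inj_eq[OF bij_is_inj])
    have "theta scale (v, f) (inv_into UNIV f (y - scale \<alpha> v), \<alpha>) = (y, \<alpha>)" for y \<alpha>
      using bij by (simp add: bij_is_surj surj_f_inv_f)
    then show "surj (theta scale (v, f))"
      unfolding surj_def by (metis surj_pair)
  qed
qed

lemma theta_mult:
  assumes "Vector_Spaces.linear scale scale g"
  shows "theta scale (w + g v, g \<circ> f) = theta scale (w, g) \<circ> theta scale (v, f)"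
  using assms by (auto simp: fun_eq_iff Vector_Spaces.linear_iff algebra_simps)

end

section \<open>Multiplicativity\<close>

context bernstein_operator
begin

lemma mul_add_left: "mul (x + y) z = mul x z + mul y z"
  and mul_add_right: "mul z (x + y) = mul z x + mul z y"
  and mul_scale_left: "mul (smul c x) z = smul c (mul x z)"
  and mul_scale_right: "mul z (smul c x) = smul c (mul z x)"
  and operator_add: "\<Omega> (x + y) = \<Omega> x + \<Omega> y"
  and operator_scale: "\<Omega> (smul c x) = smul c (\<Omega> x)"
  using linear_mult_left linear_mult_right linear_operator
  by (simp_all add: Vector_Spaces.linear_iff)

lemma mul_zero: "mul 0 x = 0" "mul x 0 = 0" and operator_zero: "\<Omega> 0 = 0"
  using mul_scale_left[of 0 0 x] mul_scale_right[of x 0 0] operator_scale[of 0 0] by simp_all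

text \<open>
  The three conditions on \<open>(v, f)\<close> come from the products \<open>(x, 0) \<circ> (y, 0)\<close>, \<open>(0, 1) \<circ> (0, 1)\<close> and
  \<open>(x, 0) \<circ> (0, 1)\<close>, which determine a commutative bilinear product.  As \<open>2\<close> is invertible,
  the two halves of \<open>\<Omega>(v)\<close> in the second product add up to \<open>\<Omega>(v)\<close>, and the third product, which
  yields half of the condition on \<open>f \<circ> \<Omega> - \<Omega> \<circ> f\<close>, can be doubled.
\<close>
lemma theta_multiplicative_iff:
  assumes two: "(2::'k) \<noteq> 0" and lin: "Vector_Spaces.linear smul smul f"
  shows "(\<forall>a b. theta smul (v, f) (semidirect_mul smul mul \<Omega> a b) =
      semidirect_mul smul mul \<Omega> (theta smul (v, f) a) (theta smul (v, f) b)) \<longleftrightarrow>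
    (\<forall>x y. f (mul x y) = mul (f x) (f y)) \<and> \<Omega> v = v - mul v v \<and>
      (\<forall>x. f (\<Omega> x) - \<Omega> (f x) = smul 2 (mul (f x) v))"
    (is "?hom \<longleftrightarrow> ?cond")
proof -
  have f_add: "f (x + y) = f x + f y" and f_scale: "f (smul c x) = smul c (f x)" for x y c
    using lin by (simp_all add: Vector_Spaces.linear_iff)
  have f_zero: "f 0 = 0"
    using f_scale[of 0 0] by simp
  have half: "smul (1/2) x + smul (1/2) x = x" for x
    using two by (simp flip: scale_left_distrib)
  have double_half: "smul 2 (smul (1/2) x) = x" for x
    using two by simp
  note simps = semidirect_mul_def f_add f_scale f_zero mul_add_left mul_add_right mul_scale_left
    mul_scale_right operator_add operator_scale mul_zero operator_zero
  show ?thesis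
  proof
    assume hom: ?hom
    have "f (mul x y) = mul (f x) (f y)" for x y
      using hom[rule_format, of "(x, 0)" "(y, 0)"] by (simp add: simps)
    moreover have "\<Omega> v = v - mul v v"
    proof -
      have "v = mul v v + smul (1/2) (\<Omega> v) + smul (1/2) (\<Omega> v)"
        using hom[rule_format, of "(0, 1)" "(0, 1)"] by (simp add: simps)
      also have "\<dots> = mul v v + \<Omega> v"
        by (simp only: add.assoc half)
      finally show ?thesis
        by (metis add_diff_cancel_left')
    qed
    moreover have "f (\<Omega> x) - \<Omega> (f x) = smul 2 (mul (f x) v)" for x
    proof -
      have "smul (1/2) (f (\<Omega> x)) = mul (f x) v + smul (1/2) (\<Omega> (f x))"
        using hom[rule_format, of "(x, 0)" "(0, 1)"] by (simp add: simps)
      then have "smul 2 (smul (1/2) (f (\<Omega> x))) = smul 2 (mul (f x) v + smul (1/2) (\<Omega> (f x)))"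
        by (rule arg_cong)
      then have "f (\<Omega> x) = smul 2 (mul (f x) v) + \<Omega> (f x)"
        by (simp only: scale_right_distrib double_half)
      then show ?thesis
        by simp
    qed
    ultimately show ?cond
      by blast
  next
    assume cond: ?cond
    then have f_mul: "f (mul x y) = mul (f x) (f y)" for x y
      by blast
    have f_operator: "smul (1/2 * \<alpha>) (f (\<Omega> x)) = smul \<alpha> (mul (f x) v) + smul (1/2 * \<alpha>) (\<Omega> (f x))"
      for \<alpha> x
    proof -
      have "f (\<Omega> x) = smul 2 (mul (f x) v) + \<Omega> (f x)"
        using cond by (metis diff_add_cancel)
      then show ?thesis
        using two by (simp add: scale_right_distrib)
    qed
    have v: "smul c v = smul c (mul v v) + smul (1/2 * c) (\<Omega> v) + smul (1/2 * c) (\<Omega> v)" for c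
    proof -
      have "v = mul v v + (smul (1/2) (\<Omega> v) + smul (1/2) (\<Omega> v))"
        using cond by (simp add: half)
      then have "smul c v = smul c (mul v v + (smul (1/2) (\<Omega> v) + smul (1/2) (\<Omega> v)))"
        by (rule arg_cong)
      then show ?thesis
        by (simp add: scale_right_distrib add.assoc)
    qed
    show ?hom
    proof clarify
      fix x y \<alpha> \<beta>
      have "f (mul x y + smul (1/2 * \<alpha>) (\<Omega> y) + smul (1/2 * \<beta>) (\<Omega> x)) + smul (\<alpha> * \<beta>) v =
        mul (f x + smul \<alpha> v) (f y + smul \<beta> v) + smul (1/2 * \<alpha>) (\<Omega> (f y + smul \<beta> v)) +
          smul (1/2 * \<beta>) (\<Omega> (f x + smul \<alpha> v))"
        unfolding f_add f_scale f_mul f_operator v[of "\<alpha> * \<beta>"]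
        by (simp add: simps scale_right_distrib mult_commute[of v "f y"] mult.commute[of \<beta> \<alpha>] add_ac)
      then show "theta smul (v, f) (semidirect_mul smul mul \<Omega> (x, \<alpha>) (y, \<beta>)) =
        semidirect_mul smul mul \<Omega> (theta smul (v, f) (x, \<alpha>)) (theta smul (v, f) (y, \<beta>))"
        by (simp add: semidirect_mul_def)
    qed
  qed
qed

lemma theta_in_Aut_Ber_iff:
  assumes "(2::'k) \<noteq> 0"
  shows "theta smul (v, f) \<in>
      carrier (Aut_Ber (semidirect_smul smul) (semidirect_mul smul mul \<Omega>) snd) \<longleftrightarrow>
    (v, f) \<in> carrier (A_group smul mul \<Omega>)"
proof -
  have "snd \<circ> theta smul (v, f) = snd"
    by (auto simp: fun_eq_iff)
  then show ?thesis
    using theta_multiplicative_iff[OF assms, of f v]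
    by (auto simp: Aut_Ber_def bernstein_hom_def algebra_hom_def A_group_def algebra_auts_def
        linear_theta_iff bij_theta_iff)
qed

section \<open>The isomorphism\<close>

lemma A_group_mult: "(w, g) \<otimes>\<^bsub>A_group smul mul \<Omega>\<^esub> (v, f) = (w + g v, g \<circ> f)"
  and A_group_one: "\<one>\<^bsub>A_group smul mul \<Omega>\<^esub> = (0, id)"
  by (simp_all add: A_group_def semidirect_GL_def)

lemma theta_A_group_mult:
  assumes "p \<in> carrier (A_group smul mul \<Omega>)"
  shows "theta smul (p \<otimes>\<^bsub>A_group smul mul \<Omega>\<^esub> q) = theta smul p \<circ> theta smul q"
proof (cases p, cases q)
  fix w g v f
  assume eqs: "p = (w, g)" "q = (v, f)"
  then have "Vector_Spaces.linear smul smul g"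
    using assms by (simp add: A_group_def algebra_auts_def algebra_hom_def)
  then show ?thesis
    by (simp add: eqs A_group_mult theta_mult)
qed

lemma theta_iso:
  assumes two: "(2::'k) \<noteq> 0"
  shows "theta smul \<in> iso (A_group smul mul \<Omega>)
    (Aut_Ber (semidirect_smul smul) (semidirect_mul smul mul \<Omega>) snd)"
    (is "_ \<in> iso ?A ?B")
proof (rule isoI)
  have mem_iff: "theta smul p \<in> carrier ?B \<longleftrightarrow> p \<in> carrier ?A" for p
    using theta_in_Aut_Ber_iff[OF two] by (cases p) simp
  show "theta smul \<in> hom ?A ?B"
    by (rule homI) (simp_all only: mem_iff theta_A_group_mult, simp add: Aut_Ber_def)
  have "\<psi> \<in> theta smul ` carrier ?A" if \<psi>: "\<psi> \<in> carrier ?B" for \<psi>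
  proof -
    from \<psi> have "\<psi> = theta smul (fst (\<psi> (0, 1)), \<lambda>x. fst (\<psi> (x, 0)))"
      by (intro weight_preserving_linear_is_theta)
        (simp_all add: Aut_Ber_def bernstein_hom_def algebra_hom_def)
    then show ?thesis
      using \<psi> mem_iff by (metis image_eqI)
  qed
  then show "bij_betw (theta smul) (carrier ?A) (carrier ?B)"
    by (auto simp: bij_betw_def mem_iff intro: inj_on_subset[OF inj_theta])
qed

text \<open>
  The group axioms are pulled back along the injection \<open>\<theta>\<close>: each equation is checked in the
  automorphism group, and the inverse of \<open>p\<close> is a preimage of the inverse of \<open>\<theta>(p)\<close>.
\<close>
lemma group_A_group:
  assumes two: "(2::'k) \<noteq> 0"
  shows "group (A_group smul mul \<Omega>)"
proof -
  let ?A = "A_group smul mul \<Omega>"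
  let ?B = "Aut_Ber (semidirect_smul smul) (semidirect_mul smul mul \<Omega>) snd"
  interpret S: bernstein_algebra "semidirect_smul smul" "semidirect_mul smul mul \<Omega>" snd
    by (rule bernstein_algebra_semidirect[OF two])
  interpret B: group ?B
    by (rule S.group_Aut_Ber)
  have mem_iff: "theta smul p \<in> carrier ?B \<longleftrightarrow> p \<in> carrier ?A" for p
    using theta_in_Aut_Ber_iff[OF two] by (cases p) simp
  have theta_eqI: "p = q" if "theta smul p = theta smul q" for p q
    using inj_theta that by (rule injD)
  have theta_hom: "theta smul (p \<otimes>\<^bsub>?A\<^esub> q) = theta smul p \<otimes>\<^bsub>?B\<^esub> theta smul q"
    if "p \<in> carrier ?A" for p q
    using that by (simp add: theta_A_group_mult Aut_Ber_def)
  have theta_one: "theta smul \<one>\<^bsub>?A\<^esub> = \<one>\<^bsub>?B\<^esub>"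
    by (auto simp: A_group_one Aut_Ber_def fun_eq_iff)
  have closed: "p \<otimes>\<^bsub>?A\<^esub> q \<in> carrier ?A" if "p \<in> carrier ?A" "q \<in> carrier ?A" for p q
    using that mem_iff theta_hom B.m_closed by metis
  have one_closed: "\<one>\<^bsub>?A\<^esub> \<in> carrier ?A"
    using mem_iff theta_one B.one_closed by metis
  show ?thesis
  proof (rule groupI)
    fix p q r
    assume "p \<in> carrier ?A" "q \<in> carrier ?A" "r \<in> carrier ?A"
    then show "p \<otimes>\<^bsub>?A\<^esub> q \<otimes>\<^bsub>?A\<^esub> r = p \<otimes>\<^bsub>?A\<^esub> (q \<otimes>\<^bsub>?A\<^esub> r)"
      by (intro theta_eqI) (simp add: theta_hom closed mem_iff B.m_assoc)
  next
    fix p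
    assume p: "p \<in> carrier ?A"
    then show "\<one>\<^bsub>?A\<^esub> \<otimes>\<^bsub>?A\<^esub> p = p"
      by (intro theta_eqI) (simp add: theta_hom theta_one one_closed mem_iff)
    have "inv\<^bsub>?B\<^esub> (theta smul p) \<in> carrier ?B"
      using p by (simp add: mem_iff)
    then obtain q where q: "q \<in> carrier ?A" "inv\<^bsub>?B\<^esub> (theta smul p) = theta smul q"
      using theta_iso[OF two] unfolding iso_def bij_betw_def by blast
    have "theta smul (q \<otimes>\<^bsub>?A\<^esub> p) = theta smul \<one>\<^bsub>?A\<^esub>"
      using p q by (simp add: theta_hom theta_one mem_iff flip: q(2))
    then show "\<exists>q\<in>carrier ?A. q \<otimes>\<^bsub>?A\<^esub> p = \<one>\<^bsub>?A\<^esub>"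
      using q(1) theta_eqI by blast
  qed (fact closed one_closed)+
qed

end

theorem corollary2p8:
  fixes smul :: "'k::field \<Rightarrow> 'n::ab_group_add \<Rightarrow> 'n"
    and mul :: "'n \<Rightarrow> 'n \<Rightarrow> 'n"
    and \<Omega> :: "'n \<Rightarrow> 'n"
  assumes infinite_field: "infinite (UNIV :: 'k set)"
    and char_not_two: "CHAR('k) \<noteq> 2"
    and four_algebra: "four_algebra smul mul"
    and bernstein_operator: "bernstein_operator smul mul \<Omega>"
  shows "group (A_group smul mul \<Omega>) \<and>
    group (Aut_Ber (semidirect_smul smul) (semidirect_mul smul mul \<Omega>) snd) \<and>
    theta smul \<in> iso (A_group smul mul \<Omega>)
      (Aut_Ber (semidirect_smul smul) (semidirect_mul smul mul \<Omega>) snd)"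
proof -
  interpret bernstein_operator smul mul \<Omega>
    by (rule bernstein_operator)
  have two: "(2::'k) \<noteq> 0"
  proof
    assume "(2::'k) = 0"
    then have "of_nat 2 = (0::'k)"
      by simp
    then have "CHAR('k) dvd 2"
      by (simp only: of_nat_eq_0_iff_char_dvd)
    then have "CHAR('k) \<noteq> 0" "CHAR('k) \<le> 2"
      by (metis dvd_0_left zero_neq_numeral, intro dvd_imp_le) simp_all
    then show False
      using char_not_two CHAR_not_1[where 'a = 'k] by linarith
  qed
  interpret S: bernstein_algebra "semidirect_smul smul" "semidirect_mul smul mul \<Omega>" snd
    by (rule bernstein_algebra_semidirect[OF two])
  show ?thesis
    using group_A_group[OF two] S.group_Aut_Ber theta_iso[OF two] by blast
qed

end
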